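(* Let $t>0$, $n=3^t-1$ and $\nu=n/2$. Let $\Lambda_n\subseteq\mathbb{Z}^n$ be the lattice generated by $\{3e_{2i-1}+2e_{2i}: 1\le i\le\nu\}\cup\{4e_{2i}:1\le i\le\nu\}$. Define $\phi:\mathbb{Z}_3\to\mathbb{Z}^2$ by $\phi(0)=(0,0)$, $\phi(1)=(1,2)$, $\phi(2)=(2,0)$, and $\Phi:\mathbb{Z}_3^\nu\to\mathbb{Z}^n$ by $\Phi(x_1,\dots,x_\nu)=(\phi(x_1),\phi(x_2),\dots,\phi(x_\nu))$ (concatenation). Let $C\subseteq\mathbb{Z}_3^\nu$ be a ternary perfect single-error-correcting code of length $\nu$, and let $T_n=\Phi(C)+\Lambda_n=\{\Phi(c)+Y: c\in C,\ Y\in\Lambda_n\}$. Then $T_n$ is an integer tiling of $\mathbb{Z}^n$ with $\Upsilon_n$.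
   Context: $e_r$ denotes the $r$-th unit vector in $\mathbb{Z}^n$. A ternary perfect single-error-correcting code of length $\nu$ is a set $C\subseteq\mathbb{Z}_3^\nu$ with pairwise Hamming distance at least $3$ such that every word of $\mathbb{Z}_3^\nu$ is at Hamming distance at most $1$ from some codeword. Let $\Upsilon_n=\{U\in\mathbb{Z}^n:\sum_i|x_i-u_i|\le1\text{ for some }X\in\{-1,0\}^n\}$. A set $T\subseteq\mathbb{Z}^n$ is an integer tiling with $\Upsilon_n$ if the translates $X+\Upsilon_n$, $X\in T$, partition $\mathbb{Z}^n$. *)

theory Defs
  imports
    "HOL-Library.Numeral_Type"
    "HOL-Library.Function_Algebras"
    "HOL-Library.Set_Algebras"
    "HOL-Library.Disjoint_Sets"
    "HOL-Computational_Algebra.Group_Closure"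
begin

text \<open>
  An \<open>n\<close>-tuple is a function on the indices \<open>1, \<dots>, n\<close>, extended by \<open>0\<close> to all of \<open>nat\<close>.
  Such functions form an additive subgroup of \<open>nat \<Rightarrow> 'a\<close> under pointwise addition, so
  \<open>tuples n\<close> at type \<open>int\<close> is \<open>\<int>\<close> to the \<open>n\<close>, and at the type \<open>3\<close> of integers modulo 3
  it is the set of ternary words of length \<open>n\<close>.
\<close>

definition tuples :: "nat \<Rightarrow> (nat \<Rightarrow> 'a::zero) set" where
  "tuples n = {x. \<forall>i. i \<notin> {1..n} \<longrightarrow> x i = 0}"

definition unit_vector :: "nat \<Rightarrow> nat \<Rightarrow> int" where
  "unit_vector r = (\<lambda>i. if i = r then 1 else 0)"

definition hamming_distance :: "nat \<Rightarrow> (nat \<Rightarrow> 'a) \<Rightarrow> (nat \<Rightarrow> 'a) \<Rightarrow> nat" where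
  "hamming_distance n x y = card {i \<in> {1..n}. x i \<noteq> y i}"

definition ternary_perfect_code :: "nat \<Rightarrow> (nat \<Rightarrow> 3) set \<Rightarrow> bool" where
  "ternary_perfect_code \<nu> C \<longleftrightarrow>
     C \<subseteq> tuples \<nu> \<and>
     (\<forall>c\<in>C. \<forall>d\<in>C. c \<noteq> d \<longrightarrow> 3 \<le> hamming_distance \<nu> c d) \<and>
     (\<forall>w\<in>tuples \<nu>. \<exists>c\<in>C. hamming_distance \<nu> w c \<le> 1)"

definition Upsilon :: "nat \<Rightarrow> (nat \<Rightarrow> int) set" where
  "Upsilon n = {u \<in> tuples n. \<exists>x\<in>tuples n. (\<forall>i\<in>{1..n}. x i \<in> {-1, 0}) \<and>
                  (\<Sum>i\<in>{1..n}. \<bar>x i - u i\<bar>) \<le> 1}"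

text \<open>
  The translates are disjoint as a family indexed by the points of \<open>T\<close>, so distinct points
  give disjoint translates.
\<close>

definition integer_tiling :: "nat \<Rightarrow> (nat \<Rightarrow> int) set \<Rightarrow> (nat \<Rightarrow> int) set \<Rightarrow> bool" where
  "integer_tiling n S T \<longleftrightarrow>
     T \<subseteq> tuples n \<and>
     (\<Union>x\<in>T. x +o S) = tuples n \<and>
     disjoint_family_on (\<lambda>x. x +o S) T"

definition Lambda :: "nat \<Rightarrow> (nat \<Rightarrow> int) set" where
  "Lambda n = group_closure
     ({\<lambda>j. 3 * unit_vector (2 * i - 1) j + 2 * unit_vector (2 * i) j | i. i \<in> {1..n div 2}} \<union>
      {\<lambda>j. 4 * unit_vector (2 * i) j | i. i \<in> {1..n div 2}})"

definition phi :: "3 \<Rightarrow> int \<times> int" where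
  "phi a = (if a = 0 then (0, 0) else if a = 1 then (1, 2) else (2, 0))"

text \<open>The pair \<open>phi (x i)\<close> occupies the positions \<open>2 * i - 1\<close> and \<open>2 * i\<close>.\<close>

definition Phi :: "nat \<Rightarrow> (nat \<Rightarrow> 3) \<Rightarrow> nat \<Rightarrow> int" where
  "Phi \<nu> x = (\<lambda>j. if j \<in> {1..2 * \<nu>}
                   then if odd j then fst (phi (x ((j + 1) div 2))) else snd (phi (x (j div 2)))
                   else 0)"

end

theory Submission
  imports Defs
begin

text \<open>
  Split a point of \<open>\<int>\<^sup>2\<^sup>\<nu>\<close> into \<open>\<nu>\<close> consecutive pairs. On a pair \<open>(a, b)\<close> the lattice is given by the
  congruences \<open>3 dvd a\<close> and \<open>4 dvd 2 * a + b\<close>, so it has index 12 in the plane, and \<open>phi s\<close> represents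
  the coset with \<open>a\<close> congruent to \<open>s\<close> modulo 3 and \<open>4 dvd 2 * a + b\<close>. A point of \<open>Upsilon (2 * \<nu>)\<close> has
  all its pairs in the square \<open>{-1, 0}\<^sup>2\<close> except at most one, which lies in the 12-element planar
  \<open>Upsilon 2\<close>. The square is a transversal for \<open>2 * a + b\<close> modulo 4, and \<open>Upsilon 2\<close> is a
  transversal for all 12 cosets. Hence subtracting a point of \<open>Upsilon (2 * \<nu>)\<close> so as to make every
  \<open>2 * a + b\<close> divisible by 4 leaves exactly the freedom to change one letter of a ternary word,
  and the perfect code turns this into a tiling.
\<close>

section \<open>Generated subgroups and pointwise sums\<close>

lemma group_closure_sum_mem:
  assumes "\<And>i. i \<in> X \<Longrightarrow> f i \<in> group_closure S"
  shows "sum f X \<in> group_closure S"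
  using assms by (induction X rule: infinite_finite_induct) (auto intro: group_closure_add)

lemma group_closure_int_scale:
  fixes s :: "'a \<Rightarrow> int"
  assumes "s \<in> group_closure S"
  shows "(\<lambda>j. k * s j) \<in> group_closure S"
proof (induction k rule: int_induct [where k = 0])
  case base
  have "(\<lambda>j. 0 * s j) = 0" by (auto simp: fun_eq_iff)
  then show ?case by (simp only: zero_in_group_closure)
next
  case (step1 k)
  have "(\<lambda>j. (k + 1) * s j) = (\<lambda>j. k * s j) + s" by (auto simp: fun_eq_iff algebra_simps)
  with step1 assms show ?case by (simp only: group_closure_add)
next
  case (step2 k)
  have "(\<lambda>j. (k - 1) * s j) = (\<lambda>j. k * s j) - s" by (auto simp: fun_eq_iff algebra_simps)
  with step2 assms show ?case by (simp only: group_closure.diff)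
qed

lemma sum_fun_apply:
  fixes f :: "'i \<Rightarrow> 'a \<Rightarrow> 'b::comm_monoid_add"
  shows "sum f X j = (\<Sum>i\<in>X. f i j)"
  by (induction X rule: infinite_finite_induct) auto

section \<open>Ternary letters as residues modulo 3\<close>

lemma ternary_cases: "a = 0 \<or> a = 1 \<or> a = (2::3)"
proof (cases a)
  case (of_int z)
  then have "z = 0 \<or> z = 1 \<or> z = 2" by auto
  with of_int show ?thesis by auto
qed

lemma phi_dvd: "4 dvd 2 * fst (phi s) + snd (phi s)"
  by (simp add: phi_def)

text \<open>The first components of \<open>phi\<close> are 0, 1, 2, which are distinct modulo 3, so
  a first coordinate modulo 3 determines the letter.\<close>

lemma phi_eqI:
  assumes "3 dvd m - fst (phi a)" "3 dvd m - fst (phi b)"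
  shows "a = b"
proof -
  have "3 dvd fst (phi b) - fst (phi a)"
    using dvd_diff [OF assms] by simp
  then show ?thesis
    using ternary_cases [of a] ternary_cases [of b] by (auto simp: phi_def)
qed

lemma ex_phi: "\<exists>s. 3 dvd m - fst (phi s)"
proof -
  have "3 dvd m \<or> 3 dvd m - 1 \<or> 3 dvd m - 2" by presburger
  moreover have "fst (phi 0) = 0" "fst (phi 1) = 1" "fst (phi 2) = 2"
    by (auto simp: phi_def)
  ultimately show ?thesis by (metis diff_zero)
qed

section \<open>Planar transversals\<close>

definition planar_cell :: "int \<Rightarrow> int \<Rightarrow> bool" where
  "planar_cell p q \<longleftrightarrow> p \<in> {-1, 0} \<and> q \<in> {-1, 0}"

text \<open>\<open>Upsilon 2\<close> written on a pair: the four points of the square and their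
  eight neighbours.\<close>

definition planar_star :: "int \<Rightarrow> int \<Rightarrow> bool" where
  "planar_star p q \<longleftrightarrow> p \<in> {-1, 0} \<and> q \<in> {-2..1} \<or> p \<in> {-2..1} \<and> q \<in> {-1, 0}"

lemma planar_cell_imp_star: "planar_cell p q \<Longrightarrow> planar_star p q"
  by (auto simp: planar_cell_def planar_star_def)

text \<open>On the square \<open>2 * p + q\<close> takes the values -3, -2, -1, 0, one for each
  residue modulo 4.\<close>

lemma planar_cell_ex:
  fixes a b :: int
  shows "\<exists>p q. planar_cell p q \<and> 4 dvd 2 * (a - p) + (b - q)"
  unfolding planar_cell_def by simp presburger

lemma planar_cell_unique:
  assumes "planar_cell p q" "planar_cell p' q'"
    and "4 dvd 2 * (a - p) + (b - q)" "4 dvd 2 * (a - p') + (b - q')"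
  shows "p = p' \<and> q = q'"
  using assms unfolding planar_cell_def by simp presburger

text \<open>The twelve points of the star realise all twelve combinations of residues modulo 3 and
  4. The free \<open>r\<close> lets a codeword letter prescribe the first residue.\<close>

lemma planar_star_ex:
  fixes a b r :: int
  shows "\<exists>p q. planar_star p q \<and> 3 dvd a - p - r \<and> 4 dvd 2 * (a - p) + (b - q)"
proof -
  have "\<exists>p q. planar_star p q \<and> 3 dvd m - p \<and> 4 dvd k - (2 * p + q)" for m k :: int
    unfolding planar_star_def by simp presburger
  from this [of "a - r" "2 * a + b"] show ?thesis
    by (simp add: algebra_simps)
qed

lemma planar_star_unique:
  assumes "planar_star p q" "planar_star p' q'"
    and "3 dvd a - p - r" "3 dvd a - p' - r"
    and "4 dvd 2 * (a - p) + (b - q)" "4 dvd 2 * (a - p') + (b - q')"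
  shows "p = p' \<and> q = q'"
proof -
  have p: "3 dvd p - p'" using dvd_diff [OF assms(4,3)] by simp
  have "4 dvd (2 * (a - p') + (b - q')) - (2 * (a - p) + (b - q))"
    using assms by (intro dvd_diff)
  then have q: "4 dvd 2 * (p - p') + (q - q')" by (simp add: algebra_simps)
  have range: "p \<in> {-2..1}" "p' \<in> {-2..1}" "q \<in> {-2..1}" "q' \<in> {-2..1}"
    using assms(1,2) by (auto simp: planar_star_def)
  have "p = p' \<or> p = -2 \<and> p' = 1 \<or> p = 1 \<and> p' = -2"
    using p range(1,2) by simp presburger
  \<comment> \<open>A first coordinate -2 or 1 confines the second to -1 and 0. Here
    \<open>2 * (p - p')\<close> is 6 or -6, so \<open>q - q'\<close> would have to be 2 modulo 4,
    yet it is at most 1 in absolute value.\<close>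
  moreover have False if "p = -2 \<and> p' = 1 \<or> p = 1 \<and> p' = -2"
  proof -
    have "q \<in> {-1, 0}" "q' \<in> {-1, 0}" using assms(1,2) that by (auto simp: planar_star_def)
    then show False using q that by auto
  qed
  moreover have "q = q'" if "p = p'"
    using q range(3,4) that by simp presburger
  ultimately show ?thesis by blast
qed

section \<open>Positions grouped into pairs\<close>

lemma double_index_cases:
  assumes "j \<in> {1..2 * \<nu>::nat}"
  obtains i where "i \<in> {1..\<nu>}" "j = 2 * i - 1" | i where "i \<in> {1..\<nu>}" "j = 2 * i"
proof (cases "odd j")
  case True
  with assms have "(j + 1) div 2 \<in> {1..\<nu>}" "j = 2 * ((j + 1) div 2) - 1"
    by (auto elim!: oddE)
  then show ?thesis using that(1) by blast
next
  case False
  with assms have "j div 2 \<in> {1..\<nu>}" "j = 2 * (j div 2)"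
    by (auto elim!: evenE)
  then show ?thesis using that(2) by blast
qed

lemma tuples_double_eqI:
  assumes "v \<in> tuples (2 * \<nu>)" "w \<in> tuples (2 * \<nu>)"
    and "\<And>i. i \<in> {1..\<nu>} \<Longrightarrow> v (2 * i - 1) = w (2 * i - 1) \<and> v (2 * i) = w (2 * i)"
  shows "v = w"
proof
  fix j
  show "v j = w j"
  proof (cases "j \<in> {1..2 * \<nu>}")
    case True
    then show ?thesis by (rule double_index_cases) (use assms(3) in blast)+
  next
    case False
    with assms(1,2) show ?thesis by (simp add: tuples_def)
  qed
qed

section \<open>The lattice and its translates as congruences\<close>

lemma Phi_pair:
  assumes "i \<in> {1..\<nu>}"
  shows "Phi \<nu> c (2 * i - 1) = fst (phi (c i))" "Phi \<nu> c (2 * i) = snd (phi (c i))"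
  using assms by (auto simp: Phi_def)

text \<open>Each generator is supported on one pair. There (3, 2) and (0, 4) span the points (3a, 2a
  + 4b), and twice the first coordinate plus the second is 8a + 4b.\<close>

lemma Lambda_iff:
  "v \<in> Lambda (2 * \<nu>) \<longleftrightarrow>
     v \<in> tuples (2 * \<nu>) \<and> (\<forall>i\<in>{1..\<nu>}. 3 dvd v (2 * i - 1) \<and> 4 dvd 2 * v (2 * i - 1) + v (2 * i))"
proof -
  \<comment> \<open>Positive indices matter: truncated subtraction makes \<open>2 * 0 - 1\<close>
    equal to \<open>2 * 0\<close>.\<close>
  have odd_even: "2 * i \<noteq> 2 * k - Suc 0" "2 * k - Suc 0 \<noteq> 2 * i"
      "2 * i - Suc 0 = 2 * k - Suc 0 \<longleftrightarrow> i = k"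
    if "i \<in> {1..\<nu>}" "k \<in> {1..\<nu>}" for i k
    using that by (auto, presburger+)
  show ?thesis
  proof (intro iffI conjI ballI)
    assume "v \<in> Lambda (2 * \<nu>)"
    then have v: "v \<in> group_closure
       ({\<lambda>j. 3 * unit_vector (2 * i - 1) j + 2 * unit_vector (2 * i) j | i. i \<in> {1..\<nu>}} \<union>
        {\<lambda>j. 4 * unit_vector (2 * i) j | i. i \<in> {1..\<nu>}})"
      by (simp add: Lambda_def)
    then show "v \<in> tuples (2 * \<nu>)"
      by induction (auto simp: tuples_def unit_vector_def)
    fix k assume k: "k \<in> {1..\<nu>}"
    from v show "3 dvd v (2 * k - 1)"
      by induction (use k in \<open>auto simp: unit_vector_def odd_even intro!: dvd_diff\<close>)
    from v show "4 dvd 2 * v (2 * k - 1) + v (2 * k)"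
    proof induction
      case (base s)
      then show ?case
        using k by (auto simp: unit_vector_def odd_even)
    next
      case (diff s t)
      from dvd_diff [OF diff.IH] show ?case by (simp add: algebra_simps)
    qed
  next
    assume "v \<in> tuples (2 * \<nu>) \<and>
      (\<forall>i\<in>{1..\<nu>}. 3 dvd v (2 * i - 1) \<and> 4 dvd 2 * v (2 * i - 1) + v (2 * i))"
    then have v: "v \<in> tuples (2 * \<nu>)"
      and v3: "\<And>i. i \<in> {1..\<nu>} \<Longrightarrow> 3 dvd v (2 * i - 1)"
      and v4: "\<And>i. i \<in> {1..\<nu>} \<Longrightarrow> 4 dvd 2 * v (2 * i - 1) + v (2 * i)"
      by auto
    define a where "a = (\<lambda>i. v (2 * i - 1) div 3)"
    define b where "b = (\<lambda>i. (v (2 * i) - 2 * a i) div 4)"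
    have ab: "v (2 * i - 1) = 3 * a i" "v (2 * i) = 2 * a i + 4 * b i" if "i \<in> {1..\<nu>}" for i
    proof -
      show a: "v (2 * i - 1) = 3 * a i" using v3 [OF that] by (simp add: a_def)
      \<comment> \<open>\<open>6 * a i\<close> and \<open>- 2 * a i\<close> agree modulo 4, their
        difference being \<open>8 * a i\<close>.\<close>
      have "4 dvd v (2 * i) - 2 * a i" using v4 [OF that] unfolding a by presburger
      then show "v (2 * i) = 2 * a i + 4 * b i" by (simp add: b_def)
    qed
    define g where "g = (\<lambda>i j. 3 * unit_vector (2 * i - 1) j + 2 * unit_vector (2 * i) j)"
    define h where "h = (\<lambda>i j. 4 * unit_vector (2 * i) j)"
    define w where "w = (\<Sum>i\<in>{1..\<nu>}. (\<lambda>j. a i * g i j) + (\<lambda>j. b i * h i j))"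
    have w_apply: "w j = (\<Sum>i\<in>{1..\<nu>}. a i * g i j + b i * h i j)" for j
      by (simp add: w_def sum_fun_apply)
    have "w \<in> tuples (2 * \<nu>)"
      by (auto simp: tuples_def w_apply g_def h_def unit_vector_def intro!: sum.neutral)
    have "v = w"
    proof (rule tuples_double_eqI [OF v \<open>w \<in> tuples (2 * \<nu>)\<close>])
      fix k assume k: "k \<in> {1..\<nu>}"
      have "w (2 * k - 1) = (\<Sum>i\<in>{1..\<nu>}. if i = k then 3 * a k else 0)"
        unfolding w_apply using k
        by (intro sum.cong refl) (auto simp: g_def h_def unit_vector_def odd_even)
      moreover have "w (2 * k) = (\<Sum>i\<in>{1..\<nu>}. if i = k then 2 * a k + 4 * b k else 0)"
        unfolding w_apply using k
        by (intro sum.cong refl) (auto simp: g_def h_def unit_vector_def odd_even)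
      ultimately show "v (2 * k - 1) = w (2 * k - 1) \<and> v (2 * k) = w (2 * k)"
        using k ab by simp
    qed
    have "w \<in> Lambda (2 * \<nu>)"
      unfolding w_def Lambda_def
      by (intro group_closure_sum_mem group_closure_add group_closure_int_scale group_closure.base)
        (auto simp: g_def h_def)
    with \<open>v = w\<close> show "v \<in> Lambda (2 * \<nu>)" by simp
  qed
qed

text \<open>By \<open>phi_dvd\<close>, subtracting a value of \<open>phi\<close> preserves the
  congruence modulo 4, so the letters of \<open>c\<close> are visible only modulo 3.\<close>

lemma diff_Phi_in_Lambda_iff:
  "v - Phi \<nu> c \<in> Lambda (2 * \<nu>) \<longleftrightarrow>
     v \<in> tuples (2 * \<nu>) \<and>
     (\<forall>i\<in>{1..\<nu>}. 3 dvd v (2 * i - 1) - fst (phi (c i)) \<and> 4 dvd 2 * v (2 * i - 1) + v (2 * i))"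
proof -
  have "v - Phi \<nu> c \<in> tuples (2 * \<nu>) \<longleftrightarrow> v \<in> tuples (2 * \<nu>)"
    by (auto simp: tuples_def Phi_def)
  moreover have "4 dvd 2 * (v (2 * i - 1) - fst (phi (c i))) + (v (2 * i) - snd (phi (c i))) \<longleftrightarrow>
      4 dvd 2 * v (2 * i - 1) + v (2 * i)" for i
    using dvd_diff_left_iff [OF phi_dvd [of "c i"], of "2 * v (2 * i - 1) + v (2 * i)"]
    by (simp add: algebra_simps)
  ultimately show ?thesis
    by (simp add: Lambda_iff Phi_pair del: One_nat_def)
qed

section \<open>The tile by coordinates and by pairs\<close>

lemma Upsilon_iff_coordinates:
  "u \<in> Upsilon n \<longleftrightarrow>
     u \<in> tuples n \<and> (\<exists>k. u k \<in> {-2..1} \<and> (\<forall>i\<in>{1..n} - {k}. u i \<in> {-1, 0}))"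
proof (intro iffI conjI)
  assume u: "u \<in> Upsilon n"
  then show ut: "u \<in> tuples n" by (simp add: Upsilon_def)
  from u obtain x where x: "\<And>i. i \<in> {1..n} \<Longrightarrow> x i \<in> {-1, 0}"
    and le: "(\<Sum>i\<in>{1..n}. \<bar>x i - u i\<bar>) \<le> 1"
    unfolding Upsilon_def by blast
  show "\<exists>k. u k \<in> {-2..1} \<and> (\<forall>i\<in>{1..n} - {k}. u i \<in> {-1, 0})"
  proof (cases "\<exists>k\<in>{1..n}. u k \<noteq> x k")
    case True
    then obtain k where k: "k \<in> {1..n}" "u k \<noteq> x k" by blast
    have sum: "(\<Sum>i\<in>{1..n}. \<bar>x i - u i\<bar>) = \<bar>x k - u k\<bar> + (\<Sum>i\<in>{1..n} - {k}. \<bar>x i - u i\<bar>)"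
      using k by (simp add: sum.remove)
    have pos: "(\<Sum>i\<in>{1..n} - {k}. \<bar>x i - u i\<bar>) \<ge> 0" by (simp add: sum_nonneg)
    have xk: "\<bar>x k - u k\<bar> \<le> 1" using sum pos le by linarith
    \<comment> \<open>The deviation at \<open>k\<close> is a nonzero integer and so already uses up
      the whole bound 1.\<close>
    have "(\<Sum>i\<in>{1..n} - {k}. \<bar>x i - u i\<bar>) = 0" using sum pos le k by linarith
    then have "u i = x i" if "i \<in> {1..n} - {k}" for i
      using that by (subst (asm) sum_nonneg_eq_0_iff) auto
    moreover have "u k \<in> {-2..1}" using xk x [OF k(1)] by auto
    ultimately show ?thesis using x by (intro exI [of _ k]) auto
  next
    case False
    \<comment> \<open>Without a deviating coordinate, position 0 serves as the exception: it lies
      outside the range, so \<open>u 0\<close> is 0.\<close>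
    then show ?thesis using x ut by (intro exI [of _ 0]) (auto simp: tuples_def)
  qed
next
  assume "u \<in> tuples n \<and> (\<exists>k. u k \<in> {-2..1} \<and> (\<forall>i\<in>{1..n} - {k}. u i \<in> {-1, 0}))"
  then obtain k where ut: "u \<in> tuples n" and k: "u k \<in> {-2..1}"
    and u: "\<And>i. i \<in> {1..n} - {k} \<Longrightarrow> u i \<in> {-1, 0}"
    by blast
  \<comment> \<open>The nearest point of the cube: 1 moves to 0 and -2 moves to -1.\<close>
  define x where "x = (\<lambda>i. if u i \<in> {-1, 0} then u i else if u i = 1 then 0 else -1)"
  have "(\<Sum>i\<in>{1..n}. \<bar>x i - u i\<bar>) \<le> (\<Sum>i\<in>{1..n}. if i = k then 1 else 0)"
  proof (rule sum_mono)
    fix i assume "i \<in> {1..n}"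
    then show "\<bar>x i - u i\<bar> \<le> (if i = k then 1 else 0)"
      using k u [of i] by (auto simp: x_def)
  qed
  also have "\<dots> \<le> 1" by simp
  finally have "(\<Sum>i\<in>{1..n}. \<bar>x i - u i\<bar>) \<le> 1" .
  moreover have "x \<in> tuples n" "\<forall>i\<in>{1..n}. x i \<in> {-1, 0}"
    using ut by (auto simp: x_def tuples_def)
  ultimately show "u \<in> Upsilon n" using ut by (auto simp: Upsilon_def)
qed

text \<open>A coordinate outside -1 and 0 affects only its own pair, and a star point has at most
  one such coordinate. A \<open>k\<close> out of range means that no pair is exceptional.\<close>

lemma Upsilon_iff_pairs:
  "u \<in> Upsilon (2 * \<nu>) \<longleftrightarrow>
     u \<in> tuples (2 * \<nu>) \<and>
     (\<exists>k. \<forall>i\<in>{1..\<nu>}. planar_star (u (2 * i - 1)) (u (2 * i)) \<and>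
                       (i \<noteq> k \<longrightarrow> planar_cell (u (2 * i - 1)) (u (2 * i))))"
proof (intro iffI conjI)
  assume "u \<in> Upsilon (2 * \<nu>)"
  then obtain j where ut: "u \<in> tuples (2 * \<nu>)" and j: "u j \<in> {-2..1}"
    and u: "\<And>i. i \<in> {1..2 * \<nu>} - {j} \<Longrightarrow> u i \<in> {-1, 0}"
    unfolding Upsilon_iff_coordinates by blast
  show "u \<in> tuples (2 * \<nu>)" by fact
  \<comment> \<open>\<open>(j + 1) div 2\<close> is the pair containing position \<open>j\<close>;
    for \<open>j = 0\<close> it is 0, which is no pair.\<close>
  have "planar_star (u (2 * i - 1)) (u (2 * i)) \<and>
      (i \<noteq> (j + 1) div 2 \<longrightarrow> planar_cell (u (2 * i - 1)) (u (2 * i)))"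
    if i: "i \<in> {1..\<nu>}" for i
  proof -
    consider "j = 2 * i - 1" | "j = 2 * i" | "j \<noteq> 2 * i - 1" "j \<noteq> 2 * i" by blast
    then show ?thesis
    proof cases
      case 1
      then have "u (2 * i) \<in> {-1, 0}" using i by (intro u) auto
      then show ?thesis using 1 i j by (auto simp: planar_star_def)
    next
      case 2
      then have "u (2 * i - 1) \<in> {-1, 0}" using i by (intro u) auto
      then show ?thesis using 2 i j by (auto simp: planar_star_def)
    next
      case 3
      then have "u (2 * i - 1) \<in> {-1, 0}" "u (2 * i) \<in> {-1, 0}" using i by (intro u; auto)+
      then have "planar_cell (u (2 * i - 1)) (u (2 * i))" by (simp add: planar_cell_def)
      then show ?thesis by (simp add: planar_cell_imp_star)
    qed
  qed
  then show "\<exists>k. \<forall>i\<in>{1..\<nu>}. planar_star (u (2 * i - 1)) (u (2 * i)) \<and>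
                       (i \<noteq> k \<longrightarrow> planar_cell (u (2 * i - 1)) (u (2 * i)))"
    by blast
next
  assume "u \<in> tuples (2 * \<nu>) \<and>
     (\<exists>k. \<forall>i\<in>{1..\<nu>}. planar_star (u (2 * i - 1)) (u (2 * i)) \<and>
                       (i \<noteq> k \<longrightarrow> planar_cell (u (2 * i - 1)) (u (2 * i))))"
  then obtain k where ut: "u \<in> tuples (2 * \<nu>)"
    and star: "\<And>i. i \<in> {1..\<nu>} \<Longrightarrow> planar_star (u (2 * i - 1)) (u (2 * i))"
    and cell: "\<And>i. i \<in> {1..\<nu>} \<Longrightarrow> i \<noteq> k \<Longrightarrow> planar_cell (u (2 * i - 1)) (u (2 * i))"
    by blast
  \<comment> \<open>This narrows the exceptional pair to one exceptional position, again with 0 as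
    the default.\<close>
  have "\<exists>l. u l \<in> {-2..1} \<and> (k \<in> {1..\<nu>} \<longrightarrow>
      (l = 2 * k - 1 \<or> u (2 * k - 1) \<in> {-1, 0}) \<and> (l = 2 * k \<or> u (2 * k) \<in> {-1, 0}))"
  proof (cases "k \<in> {1..\<nu>}")
    case True
    from star [OF True] consider "u (2 * k - 1) \<in> {-1, 0}" "u (2 * k) \<in> {-2..1}"
      | "u (2 * k - 1) \<in> {-2..1}" "u (2 * k) \<in> {-1, 0}"
      unfolding planar_star_def by blast
    then show ?thesis by cases blast+
  next
    case False
    moreover have "u 0 = 0" using ut by (simp add: tuples_def)
    ultimately show ?thesis by (intro exI [of _ 0]) auto
  qed
  then obtain l where l: "u l \<in> {-2..1}"
    and lk: "k \<in> {1..\<nu>} \<Longrightarrow> l = 2 * k - 1 \<or> u (2 * k - 1) \<in> {-1, 0}"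
      "k \<in> {1..\<nu>} \<Longrightarrow> l = 2 * k \<or> u (2 * k) \<in> {-1, 0}"
    by blast
  have "u j \<in> {-1, 0}" if j: "j \<in> {1..2 * \<nu>} - {l}" for j
  proof -
    from j have "j \<in> {1..2 * \<nu>}" by simp
    then show ?thesis
    proof (cases rule: double_index_cases)
      case (1 i)
      then show ?thesis
        using j cell [of i] lk by (cases "i = k") (auto simp: planar_cell_def)
    next
      case (2 i)
      then show ?thesis
        using j cell [of i] lk by (cases "i = k") (auto simp: planar_cell_def)
    qed
  qed
  with ut l show "u \<in> Upsilon (2 * \<nu>)" unfolding Upsilon_iff_coordinates by blast
qed

section \<open>Perfect codes in terms of exceptional positions\<close>

lemma ternary_perfect_code_eqI:
  assumes "ternary_perfect_code \<nu> C" "c \<in> C" "d \<in> C"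
    and "\<And>i. i \<in> {1..\<nu>} \<Longrightarrow> i \<noteq> k \<Longrightarrow> i \<noteq> l \<Longrightarrow> c i = d i"
  shows "c = d"
proof (rule ccontr)
  assume "c \<noteq> d"
  with assms have "3 \<le> hamming_distance \<nu> c d" by (simp add: ternary_perfect_code_def)
  \<comment> \<open>Two exceptional positions, later one from each of two overlapping translates,
    keep the distance below 3.\<close>
  moreover have "hamming_distance \<nu> c d \<le> card {k, l}"
    unfolding hamming_distance_def using assms(4) by (intro card_mono) auto
  moreover have "card {k, l} \<le> 2" by (simp add: card_insert_if)
  ultimately show False by linarith
qed

lemma ternary_perfect_code_cover:
  assumes "ternary_perfect_code \<nu> C" "w \<in> tuples \<nu>"
  obtains c k where "c \<in> C" "\<And>i. i \<in> {1..\<nu>} \<Longrightarrow> i \<noteq> k \<Longrightarrow> w i = c i"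
proof -
  from assms obtain c where c: "c \<in> C" "card {i \<in> {1..\<nu>}. w i \<noteq> c i} \<le> 1"
    by (auto simp: ternary_perfect_code_def hamming_distance_def)
  moreover have "finite {i \<in> {1..\<nu>}. w i \<noteq> c i}" by simp
  ultimately have "\<forall>i\<in>{i \<in> {1..\<nu>}. w i \<noteq> c i}. \<forall>k\<in>{i \<in> {1..\<nu>}. w i \<noteq> c i}. i = k"
    by (simp only: One_nat_def card_le_Suc0_iff_eq)
  then show ?thesis using that [OF c(1)] by blast
qed

section \<open>Covering and disjointness of the translates\<close>

lemma code_lattice_tiling:
  fixes C :: "(nat \<Rightarrow> 3) set"
  assumes C: "ternary_perfect_code \<nu> C"
  shows "integer_tiling (2 * \<nu>) (Upsilon (2 * \<nu>)) {Phi \<nu> c + y | c y. c \<in> C \<and> y \<in> Lambda (2 * \<nu>)}"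
    (is "integer_tiling _ ?U ?T")
proof -
  define T where "T = ?T"
  have T_iff: "x \<in> T \<longleftrightarrow> (\<exists>c\<in>C. x - Phi \<nu> c \<in> Lambda (2 * \<nu>))" for x
  proof
    assume "\<exists>c\<in>C. x - Phi \<nu> c \<in> Lambda (2 * \<nu>)"
    then obtain c where "c \<in> C" "x - Phi \<nu> c \<in> Lambda (2 * \<nu>)" by blast
    moreover have "x = Phi \<nu> c + (x - Phi \<nu> c)" by simp
    ultimately show "x \<in> T" unfolding T_def by blast
  next
    assume "x \<in> T"
    then obtain c y where "x = Phi \<nu> c + y" "c \<in> C" "y \<in> Lambda (2 * \<nu>)"
      unfolding T_def by blast
    moreover from this have "x - Phi \<nu> c = y" by simp
    ultimately show "\<exists>c\<in>C. x - Phi \<nu> c \<in> Lambda (2 * \<nu>)" by metis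
  qed
  then have T_tuples: "T \<subseteq> tuples (2 * \<nu>)"
    by (auto simp: diff_Phi_in_Lambda_iff)
  have add: "x + u \<in> tuples (2 * \<nu>)"
    if "x \<in> tuples (2 * \<nu>)" "u \<in> tuples (2 * \<nu>)" for x u :: "nat \<Rightarrow> int"
    using that by (simp add: tuples_def)
  have cover: "\<exists>x\<in>T. \<exists>u\<in>?U. v = x + u" if v: "v \<in> tuples (2 * \<nu>)" for v
  proof -
    \<comment> \<open>Subtracting a square point from each pair repairs the congruence modulo 4. The
      residues modulo 3 then spell a word \<open>w\<close>, not necessarily in the code.\<close>
    have "\<forall>i. \<exists>p q. planar_cell p q \<and> 4 dvd 2 * (v (2 * i - 1) - p) + (v (2 * i) - q)"
      by (intro allI planar_cell_ex)
    then obtain p q where cell: "\<And>i. planar_cell (p i) (q i)"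
      and pq: "\<And>i. 4 dvd 2 * (v (2 * i - 1) - p i) + (v (2 * i) - q i)"
      by metis
    have "\<forall>i. \<exists>s. 3 dvd v (2 * i - 1) - p i - fst (phi s)"
      by (intro allI ex_phi)
    then obtain w where w: "\<And>i. 3 dvd v (2 * i - 1) - p i - fst (phi (w i))"
      by metis
    define w' where "w' = (\<lambda>i. if i \<in> {1..\<nu>} then w i else 0)"
    have w't: "w' \<in> tuples \<nu>" by (simp add: w'_def tuples_def)
    obtain c k where c: "c \<in> C" and "\<And>i. i \<in> {1..\<nu>} \<Longrightarrow> i \<noteq> k \<Longrightarrow> w' i = c i"
      using ternary_perfect_code_cover [OF C w't] by blast
    then have wc: "\<And>i. i \<in> {1..\<nu>} \<Longrightarrow> i \<noteq> k \<Longrightarrow> w i = c i"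
      by (simp add: w'_def)
    \<comment> \<open>Only at pair \<open>k\<close> can \<open>w\<close> miss the codeword. There a
      star point replaces the square point, chosen to leave the residue of the letter
      \<open>c k\<close>.\<close>
    obtain p' q' where star: "planar_star p' q'"
      and pq': "3 dvd v (2 * k - 1) - p' - fst (phi (c k))"
        "4 dvd 2 * (v (2 * k - 1) - p') + (v (2 * k) - q')"
      using planar_star_ex by blast
    define u where "u = (\<lambda>j. if j \<in> {1..2 * \<nu>}
      then if odd j then (p(k := p')) ((j + 1) div 2) else (q(k := q')) (j div 2) else 0)"
    have u_pair: "u (2 * i - 1) = (p(k := p')) i" "u (2 * i) = (q(k := q')) i"
      if "i \<in> {1..\<nu>}" for i
      using that by (auto simp: u_def)
    have ut: "u \<in> tuples (2 * \<nu>)" by (simp add: u_def tuples_def)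
    have "u \<in> ?U"
      unfolding Upsilon_iff_pairs
      using ut star cell by (auto simp: u_pair planar_cell_imp_star simp del: One_nat_def
          intro!: exI [of _ k])
    moreover have "v - u \<in> tuples (2 * \<nu>)" using v ut by (simp add: tuples_def)
    then have "v - u - Phi \<nu> c \<in> Lambda (2 * \<nu>)"
      unfolding diff_Phi_in_Lambda_iff using pq pq' w wc
      by (auto simp: u_pair simp del: One_nat_def) metis
    then have "v - u \<in> T" using c T_iff by blast
    moreover have "v = (v - u) + u" by simp
    ultimately show ?thesis by blast
  qed
  have unique: "x = x'"
    if x: "x \<in> T" "x' \<in> T" and u: "u \<in> ?U" "u' \<in> ?U" and eq: "x + u = x' + u'" for x x' u u'
  proof -
    define v where "v = x + u"
    have x_eq: "x = v - u" and x'_eq: "x' = v - u'"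
      by (simp_all add: v_def, simp add: eq)
    from x obtain c d where c: "c \<in> C" "d \<in> C"
      and "v - u - Phi \<nu> c \<in> Lambda (2 * \<nu>)" "v - u' - Phi \<nu> d \<in> Lambda (2 * \<nu>)"
      unfolding T_iff x_eq x'_eq by blast
    then have c3: "\<And>i. i \<in> {1..\<nu>} \<Longrightarrow> 3 dvd v (2 * i - 1) - u (2 * i - 1) - fst (phi (c i))"
      and c4: "\<And>i. i \<in> {1..\<nu>} \<Longrightarrow> 4 dvd 2 * (v (2 * i - 1) - u (2 * i - 1)) + (v (2 * i) - u (2 * i))"
      and d3: "\<And>i. i \<in> {1..\<nu>} \<Longrightarrow> 3 dvd v (2 * i - 1) - u' (2 * i - 1) - fst (phi (d i))"
      and d4: "\<And>i. i \<in> {1..\<nu>} \<Longrightarrow> 4 dvd 2 * (v (2 * i - 1) - u' (2 * i - 1)) + (v (2 * i) - u' (2 * i))"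
      unfolding diff_Phi_in_Lambda_iff by auto
    from u obtain k l where ut: "u \<in> tuples (2 * \<nu>)" "u' \<in> tuples (2 * \<nu>)"
      and star: "\<And>i. i \<in> {1..\<nu>} \<Longrightarrow> planar_star (u (2 * i - 1)) (u (2 * i))"
        "\<And>i. i \<in> {1..\<nu>} \<Longrightarrow> planar_star (u' (2 * i - 1)) (u' (2 * i))"
      and cell: "\<And>i. i \<in> {1..\<nu>} \<Longrightarrow> i \<noteq> k \<Longrightarrow> planar_cell (u (2 * i - 1)) (u (2 * i))"
        "\<And>i. i \<in> {1..\<nu>} \<Longrightarrow> i \<noteq> l \<Longrightarrow> planar_cell (u' (2 * i - 1)) (u' (2 * i))"
      unfolding Upsilon_iff_pairs by blast
    \<comment> \<open>Away from \<open>k\<close> and \<open>l\<close> both tile points lie in the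
      square, where the congruence modulo 4 makes them equal. The letters then agree there too, and
      the minimum distance does the rest.\<close>
    have "c = d"
    proof (rule ternary_perfect_code_eqI [OF C c])
      fix i assume i: "i \<in> {1..\<nu>}" "i \<noteq> k" "i \<noteq> l"
      then have "u (2 * i - 1) = u' (2 * i - 1)"
        using planar_cell_unique [OF cell(1) [OF i(1,2)] cell(2) [OF i(1,3)] c4 [OF i(1)] d4 [OF i(1)]]
        by blast
      then show "c i = d i"
        using phi_eqI [OF c3 [OF i(1)]] d3 [OF i(1)] by simp
    qed
    \<comment> \<open>With a common codeword, \<open>u\<close> and \<open>u'\<close> satisfy the
      same congruences on every pair, including \<open>k\<close> and \<open>l\<close>, so uniqueness
      in the star applies.\<close>
    have "u = u'"
    proof (rule tuples_double_eqI [OF ut])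
      fix i assume i: "i \<in> {1..\<nu>}"
      from planar_star_unique [OF star(1,2) [OF i] c3 [OF i]] d3 [OF i] c4 [OF i] d4 [OF i] \<open>c = d\<close>
      show "u (2 * i - 1) = u' (2 * i - 1) \<and> u (2 * i) = u' (2 * i)" by blast
    qed
    then show ?thesis by (simp add: x_eq x'_eq)
  qed
  have U_tuples: "?U \<subseteq> tuples (2 * \<nu>)" by (auto simp: Upsilon_def)
  have "(\<Union>x\<in>T. x +o ?U) = tuples (2 * \<nu>)"
  proof (intro equalityI subsetI)
    fix v assume "v \<in> (\<Union>x\<in>T. x +o ?U)"
    then obtain x u where "x \<in> T" "u \<in> ?U" "v = x + u"
      unfolding elt_set_plus_def by blast
    with add T_tuples U_tuples show "v \<in> tuples (2 * \<nu>)" by blast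
  next
    fix v :: "nat \<Rightarrow> int" assume "v \<in> tuples (2 * \<nu>)"
    from cover [OF this] show "v \<in> (\<Union>x\<in>T. x +o ?U)"
      unfolding elt_set_plus_def by blast
  qed
  moreover have "disjoint_family_on (\<lambda>x. x +o ?U) T"
    unfolding disjoint_family_on_def elt_set_plus_def using unique by blast
  ultimately show ?thesis
    using T_tuples unfolding integer_tiling_def T_def by (intro conjI)
qed

theorem theorem8:
  fixes t n \<nu> :: nat and C :: "(nat \<Rightarrow> 3) set"
  assumes "t > 0" and "n = 3 ^ t - 1" and "\<nu> = n div 2"
    and "ternary_perfect_code \<nu> C"
  shows "integer_tiling n (Upsilon n) {Phi \<nu> c + y | c y. c \<in> C \<and> y \<in> Lambda n}"
proof -
  \<comment> \<open>Powers of 3 are odd, so \<open>n\<close> is even and the halving is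
    exact.\<close>
  have "n = 2 * \<nu>" using assms(2,3) by simp
  with code_lattice_tiling [OF assms(4)] show ?thesis by simp
qed

end
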